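(* In the duopoly setting described in the context, suppose that $f$ is symmetric around $0$ and log-concave. Then every consumer type $t\in[-1,1]$ has a strictly higher payoff in the equilibrium $E_{\mathrm{simple}}$ of the simple evidence game, and a strictly higher payoff in the equilibrium $E_{\mathrm{rich}}$ of the rich evidence game, than in the benchmark setting without personalized pricing.
   Context: Two firms $i\in\{L,R\}$ located at $\ell_L=-1$ and $\ell_R=1$ compete to sell to a single consumer with unit demand. The consumer's type (location) $t$ is drawn from an atomless distribution with CDF $F$ with support $[-1,1]$ and a strictly positive continuous density $f$ on $[-1,1]$. If she buys from firm $i$ at price $p_i$, her payoff is $V-|t-\ell_i|-p_i$ and firm $i$'s payoff is $p_i$; a firm that does not sell gets $0$. It is assumed that $V\ge2$ and $V>1/f(0)+1$, so that all types buy in all the equilibria considered. Benchmark without personalized pricing: the firms, with no information about $t$, simultaneously set uniform prices, and the consumer buys from her preferred firm. The benchmark outcome is the symmetric pure-strategy equilibrium, in which each firm charges $p^*=2F(0)/f(0)$ and each type buys from the nearer firm. Disclosure games. Before prices are set, the consumer observes $t$ and privately sends to each firm a message from $\mathcal M(t)$, where $\mathcal M(t)=\{[-1,1],\{t\}\}$ under simple evidence and $\mathcal M(t)=\{[a,b]\subseteq[-1,1]:a\le t\le b\}$ under rich evidence; firms then simultaneously set prices $p_i\ge0$ given their own messages, and the consumer buys. The following are (Perfect Bayesian) equilibria of these games. For each $i$, let $t_0^i=\ell_i$; for $s\ge1$ let $p_s^i$ be the lowest maximizer over $p\ge0$ of $p\,\ell_i\,(F(t_{s-1}^i)-F(p\ell_i/2))$,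 $t_s^i=p_s^i\ell_i/2$, and $M_s^i=\{t\in[-1,1]: t_s^i\ell_i\le t\ell_i\le t_{s-1}^i\ell_i\}$. $E_{\mathrm{simple}}$: types $t\in[-1,t_1^L]$ send $[-1,1]$ to $L$ and $\{t\}$ to $R$; types $t\in(t_1^L,t_1^R)$ send $\{t\}$ to both; types $t\in[t_1^R,1]$ send $\{t\}$ to $L$ and $[-1,1]$ to $R$. Firm $i$ charges $\max\{2t\ell_i,0\}$ after message $\{t\}$ and $p_1^i$ after message $[-1,1]$. Every type buys from the nearer firm. $E_{\mathrm{rich}}$: a type $t$ with $t_s^i\ell_i<t\ell_i\le t_{s-1}^i\ell_i$ sends $M_s^i$ to both firms, after which firm $i$ charges $p_s^i$ and the other firm charges $0$; type $t=0$ sends $\{0\}$ to both firms and both charge $0$. Every type buys from the nearer firm. *)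

theory Defs
  imports "HOL-Probability.Probability"
begin

datatype firm = L | R

primrec loc :: "firm \<Rightarrow> real" where
  "loc L = -1"
| "loc R = 1"

text \<open>\<open>D\<close> is the law of the type. Having a density, it is atomless, and as the density is
  positive exactly on \<open>[-1,1]\<close> its support is \<open>[-1,1]\<close>. The values of \<open>f\<close> outside \<open>[-1,1]\<close> are
  irrelevant.\<close>

definition duopoly :: "real measure \<Rightarrow> (real \<Rightarrow> real) \<Rightarrow> real \<Rightarrow> bool" where
  "duopoly D f V \<longleftrightarrow>
     prob_space D \<and>
     D = density lborel (\<lambda>t. ennreal (indicator {-1..1} t * f t)) \<and>
     continuous_on {-1..1} f \<and>
     (\<forall>t\<in>{-1..1}. 0 < f t) \<and>
     2 \<le> V \<and> 1 / f 0 + 1 < V"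

definition symmetric_density :: "(real \<Rightarrow> real) \<Rightarrow> bool" where
  "symmetric_density f \<longleftrightarrow> (\<forall>t\<in>{-1..1}. f (- t) = f t)"

definition log_concave_density :: "(real \<Rightarrow> real) \<Rightarrow> bool" where
  "log_concave_density f \<longleftrightarrow> concave_on {-1..1} (\<lambda>t. ln (f t))"

text \<open>A purchase strategy maps the type and the price vector to the chosen seller, \<open>None\<close> meaning
  that the consumer does not buy.\<close>

type_synonym purchase = "real \<Rightarrow> (firm \<Rightarrow> real) \<Rightarrow> firm option"

definition consumer_payoff :: "real \<Rightarrow> purchase \<Rightarrow> real \<Rightarrow> (firm \<Rightarrow> real) \<Rightarrow> real" where
  "consumer_payoff V b t q =
     (case b t q of None \<Rightarrow> 0 | Some i \<Rightarrow> V - \<bar>t - loc i\<bar> - q i)"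

text \<open>At \<open>t = 0\<close> the two firms are equidistant and either may be the seller.\<close>

definition buys_from_nearer :: "purchase \<Rightarrow> real \<Rightarrow> (firm \<Rightarrow> real) \<Rightarrow> bool" where
  "buys_from_nearer b t q \<longleftrightarrow>
     (\<exists>i. b t q = Some i \<and> (\<forall>j. \<bar>t - loc i\<bar> \<le> \<bar>t - loc j\<bar>))"

text \<open>The three equilibria are specified by the strategies played in them. Their optimality is not
  part of the specification, since it does not enter the payoff comparison.\<close>

definition benchmark_equilibrium ::
    "real measure \<Rightarrow> (real \<Rightarrow> real) \<Rightarrow> (firm \<Rightarrow> real) \<Rightarrow> purchase \<Rightarrow> bool" where
  "benchmark_equilibrium D f q b \<longleftrightarrow>
     (\<forall>i. q i = 2 * cdf D 0 / f 0) \<and> (\<forall>t\<in>{-1..1}. buys_from_nearer b t q)"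

definition simple_evidence :: "real \<Rightarrow> real set set" where
  "simple_evidence t = {{-1..1}, {t}}"

definition rich_evidence :: "real \<Rightarrow> real set set" where
  "rich_evidence t = {{a..b} | a b. -1 \<le> a \<and> a \<le> t \<and> t \<le> b \<and> b \<le> 1}"

text \<open>Strategy profiles of a disclosure game: \<open>msg i t\<close> is what type \<open>t\<close> sends to firm \<open>i\<close>, and
  \<open>price i m\<close> is what firm \<open>i\<close> charges after receiving \<open>m\<close>.\<close>

record profile =
  msg :: "firm \<Rightarrow> real \<Rightarrow> real set"
  price :: "firm \<Rightarrow> real set \<Rightarrow> real"
  buy :: purchase

definition disclosure_profile :: "(real \<Rightarrow> real set set) \<Rightarrow> profile \<Rightarrow> bool" where
  "disclosure_profile evidence E \<longleftrightarrow>
     (\<forall>t\<in>{-1..1}. \<forall>i. msg E i t \<in> evidence t) \<and> (\<forall>i m. 0 \<le> price E i m)"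

definition prices_faced :: "profile \<Rightarrow> real \<Rightarrow> firm \<Rightarrow> real" where
  "prices_faced E t = (\<lambda>i. price E i (msg E i t))"

definition disclosure_payoff :: "real \<Rightarrow> profile \<Rightarrow> real \<Rightarrow> real" where
  "disclosure_payoff V E t = consumer_payoff V (buy E) t (prices_faced E t)"

definition lowest_maximizer :: "(real \<Rightarrow> real) \<Rightarrow> firm \<Rightarrow> real \<Rightarrow> real" where
  "lowest_maximizer F i c =
     (LEAST p. is_arg_max (\<lambda>p. p * loc i * (F c - F (p * loc i / 2))) (\<lambda>p. 0 \<le> p) p)"

primrec cutoff :: "(real \<Rightarrow> real) \<Rightarrow> firm \<Rightarrow> nat \<Rightarrow> real" where
  "cutoff F i 0 = loc i"
| "cutoff F i (Suc s) = lowest_maximizer F i (cutoff F i s) * loc i / 2"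

text \<open>The price and the message with index \<open>s\<close> are meaningful for \<open>s \<ge> 1\<close> only.\<close>

definition segment_price :: "(real \<Rightarrow> real) \<Rightarrow> firm \<Rightarrow> nat \<Rightarrow> real" where
  "segment_price F i s = lowest_maximizer F i (cutoff F i (s - 1))"

definition segment :: "(real \<Rightarrow> real) \<Rightarrow> firm \<Rightarrow> nat \<Rightarrow> real set" where
  "segment F i s =
     {t\<in>{-1..1}. cutoff F i s * loc i \<le> t * loc i \<and> t * loc i \<le> cutoff F i (s - 1) * loc i}"

definition simple_equilibrium :: "real measure \<Rightarrow> profile \<Rightarrow> bool" where
  "simple_equilibrium D E \<longleftrightarrow>
     disclosure_profile simple_evidence E \<and>
     (\<forall>t\<in>{-1..cutoff (cdf D) L 1}. msg E L t = {-1..1} \<and> msg E R t = {t}) \<and>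
     (\<forall>t\<in>{cutoff (cdf D) L 1<..<cutoff (cdf D) R 1}. msg E L t = {t} \<and> msg E R t = {t}) \<and>
     (\<forall>t\<in>{cutoff (cdf D) R 1..1}. msg E L t = {t} \<and> msg E R t = {-1..1}) \<and>
     (\<forall>i. \<forall>t\<in>{-1..1}. price E i {t} = max (2 * t * loc i) 0) \<and>
     (\<forall>i. price E i {-1..1} = segment_price (cdf D) i 1) \<and>
     (\<forall>t\<in>{-1..1}. buys_from_nearer (buy E) t (prices_faced E t))"

text \<open>Prices after messages that no type sends are left open; they do not affect any payoff on
  the path of play.\<close>

definition rich_equilibrium :: "real measure \<Rightarrow> profile \<Rightarrow> bool" where
  "rich_equilibrium D E \<longleftrightarrow>
     disclosure_profile rich_evidence E \<and>
     (\<forall>i. \<forall>s\<ge>1. \<forall>t\<in>{-1..1}.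
        cutoff (cdf D) i s * loc i < t * loc i \<and>
        t * loc i \<le> cutoff (cdf D) i (s - 1) * loc i \<longrightarrow>
        (\<forall>j. msg E j t = segment (cdf D) i s)) \<and>
     (\<forall>i. \<forall>s\<ge>1. \<forall>j.
        price E j (segment (cdf D) i s) = (if j = i then segment_price (cdf D) i s else 0)) \<and>
     (\<forall>j. msg E j 0 = {0} \<and> price E j {0} = 0) \<and>
     (\<forall>t\<in>{-1..1}. buys_from_nearer (buy E) t (prices_faced E t))"

end

theory Submission
  imports Defs
begin

text \<open>Since \<open>F(0) = 1/2\<close>, every type pays \<open>1 / f(0)\<close> in the benchmark and buys from the nearer firm
  in all three outcomes, so it suffices that on the path of play the nearer firm charges less than
  \<open>1 / f(0)\<close>. By symmetry, \<open>p\<^sub>s\<close> maximizes \<open>p (F(c) - F(p/2))\<close> for some \<open>0 < c \<le> 1\<close>. At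
  \<open>x = p\<^sub>s/2\<close> the first-order condition reads \<open>x f(x) = F(c) - F(x)\<close>. Log-concavity gives
  \<open>f(u) f(0) \<le> f(x) f(u - x)\<close> for \<open>0 \<le> x \<le> u\<close>; integrating over \<open>u\<close> from \<open>x\<close> to \<open>c\<close> yields
  \<open>x f(0) \<le> F(c - x) - F(0) < 1/2\<close>, the claimed bound. Moreover \<open>f\<close> decreases on \<open>[0,1]\<close>, so
  \<open>F(c) - F(x) \<le> (c - x) f(x)\<close> and thus \<open>x \<le> c/2\<close>: the cutoffs tend to \<open>0\<close> and every type
  \<open>t \<noteq> 0\<close> lies in some segment.\<close>

locale symmetric_log_concave_duopoly =
  fixes D :: "real measure" and f :: "real \<Rightarrow> real" and V :: real
  assumes duopoly: "duopoly D f V"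
    and symmetric: "symmetric_density f"
    and log_concave: "log_concave_density f"
begin

lemma D_eq: "D = density lborel (\<lambda>t. ennreal (indicator {-1..1} t * f t))"
  using duopoly by (simp add: duopoly_def)

sublocale real_distribution D
proof (rule real_distribution.intro)
  show "prob_space D"
    using duopoly unfolding duopoly_def by (elim conjE)
  show "real_distribution_axioms D"
    by unfold_locales (simp add: D_eq)
qed

section \<open>Shape of the density: monotonicity and the log-concavity inequality\<close>

lemma continuous_density: "continuous_on {-1..1} f"
  using duopoly by (simp add: duopoly_def)

lemma density_pos: "t \<in> {-1..1} \<Longrightarrow> 0 < f t"
  using duopoly by (simp add: duopoly_def)

lemma density_uminus: "t \<in> {-1..1} \<Longrightarrow> f (- t) = f t"
  using symmetric by (simp add: symmetric_density_def)

lemma ln_density_concave: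
  assumes "x \<in> {-1..1}" "y \<in> {-1..1}" "0 \<le> u" "u \<le> 1"
  shows "(1 - u) * ln (f x) + u * ln (f y) \<le> ln (f ((1 - u) * x + u * y))"
  using concave_onD[OF log_concave[unfolded log_concave_density_def], of u x y] assms by simp

text \<open>The point \<open>x\<close> is a convex combination of \<open>u\<close> and
  \<open>- u\<close>, where symmetry gives \<open>ln (f _)\<close> the same value.\<close>

lemma density_antimono:
  assumes "0 \<le> x" "x \<le> u" "u \<le> 1"
  shows "f u \<le> f x"
proof (cases "u = 0")
  case False
  define a where "a = (u - x) / (2 * u)"
  have a: "0 \<le> a" "a \<le> 1" "(1 - a) * u + a * (- u) = x"
    using assms False by (auto simp: a_def field_simps)
  have "(1 - a) * ln (f u) + a * ln (f (- u)) \<le> ln (f x)"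
    using ln_density_concave[of u "- u" a] assms a by simp
  then have "ln (f u) \<le> ln (f x)"
    using density_uminus[of u] assms by (simp add: algebra_simps)
  then show ?thesis
    using density_pos assms by (simp add: ln_le_cancel_iff)
qed (use assms in auto)

text \<open>Both \<open>x\<close> and \<open>u - x\<close> are convex combinations of
  \<open>0\<close> and \<open>u\<close>, with the weights exchanged; adding the two concavity
  inequalities leaves total weight one on each endpoint.\<close>

lemma density_shift:
  assumes "0 \<le> x" "x \<le> u" "u \<le> 1"
  shows "f u * f 0 \<le> f x * f (u - x)"
proof (cases "u = 0")
  case False
  define a where "a = x / u"
  have a: "0 \<le> a" "a \<le> 1" "a * u = x" "(1 - a) * u = u - x"
    using assms False by (auto simp: a_def field_simps)
  have "(1 - a) * ln (f 0) + a * ln (f u) \<le> ln (f x)"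
    using ln_density_concave[of 0 u a] assms a(1-3) by simp
  moreover have "(1 - (1 - a)) * ln (f 0) + (1 - a) * ln (f u) \<le> ln (f (u - x))"
    using ln_density_concave[of 0 u "1 - a"] assms a(1,2) unfolding a(4) by simp
  ultimately have "ln (f u) + ln (f 0) \<le> ln (f x) + ln (f (u - x))"
    by (simp add: algebra_simps)
  moreover have "0 < f u" "0 < f 0" "0 < f x" "0 < f (u - x)"
    using density_pos assms by auto
  ultimately have "ln (f u * f 0) \<le> ln (f x * f (u - x))"
    by (simp add: ln_mult)
  then show ?thesis
    using \<open>0 < f u\<close> \<open>0 < f 0\<close> \<open>0 < f x\<close> \<open>0 < f (u - x)\<close> by (simp add: ln_le_cancel_iff)
qed (use assms in auto)

section \<open>The distribution function: derivative, monotonicity and symmetry\<close>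

lemma density_borel: "(\<lambda>t. indicator {-1..1} t * f t) \<in> borel_measurable borel"
  using borel_measurable_continuous_on_indicator[OF _ continuous_density] by simp

text \<open>Passes from the measure to an integral with variable upper limit, to which the
  fundamental theorem of calculus applies.\<close>

lemma cdf_eq_integral:
  assumes "x \<in> {-1..1}"
  shows "cdf D x = integral {-1..x} f"
proof -
  have cont: "continuous_on {-1..x} f"
    using continuous_density assms by (rule_tac continuous_on_subset) auto
  have int: "set_integrable lborel {-1..x} f"
    unfolding set_integrable_def
    by (rule borel_integrable_compact[OF compact_Icc cont])
  have "emeasure D {..x} = (\<integral>\<^sup>+t. ennreal (indicator {-1..1} t * f t) * indicator {..x} t \<partial>lborel)"
    unfolding D_eq using density_borel by (subst emeasure_density) auto
  also have "\<dots> = (\<integral>\<^sup>+t. ennreal (indicator {-1..x} t *\<^sub>R f t) \<partial>lborel)"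
    using assms by (intro nn_integral_cong) (auto simp: indicator_def)
  also have "\<dots> = ennreal (set_lebesgue_integral lborel {-1..x} f)"
    unfolding set_lebesgue_integral_def
    using int assms density_pos
    by (intro nn_integral_eq_integral)
      (auto simp: set_integrable_def indicator_def intro!: AE_I2 less_imp_le)
  also have "set_lebesgue_integral lborel {-1..x} f = integral {-1..x} f"
    using int by (rule set_borel_integral_eq_integral)
  finally have "emeasure D {..x} = ennreal (integral {-1..x} f)" .
  moreover have "0 \<le> integral {-1..x} f"
    using assms density_pos
    by (intro integral_nonneg integrable_continuous_real cont) (auto intro: less_imp_le)
  ultimately show ?thesis
    by (simp add: cdf_def measure_def)
qed

lemma cdf_has_derivative:
  assumes "x \<in> {-1..1}"
  shows "(cdf D has_real_derivative f x) (at x within {-1..1})"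
proof -
  have "((\<lambda>y. integral {-1..y} f) has_real_derivative f x) (at x within {-1..1})"
    using assms by (intro integral_has_real_derivative continuous_density)
  then show ?thesis
    by (rule has_field_derivative_transform_within[of _ _ _ _ 1])
      (use assms cdf_eq_integral in auto)
qed

lemma cdf_has_derivative_at:
  assumes "-1 < x" "x < 1"
  shows "(cdf D has_real_derivative f x) (at x)"
  using cdf_has_derivative[of x] assms by (simp add: at_within_Icc_at)

lemma continuous_cdf: "continuous_on {-1..1} (cdf D)"
  using cdf_has_derivative by (rule DERIV_continuous_on)

lemma cdf_increment:
  assumes "-1 \<le> x" "x < y" "y \<le> 1"
  obtains z where "x < z" "z < y" "cdf D y - cdf D x = (y - x) * f z"
proof -
  have "continuous_on {x..y} (cdf D)"
    using continuous_cdf assms by (rule_tac continuous_on_subset) auto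
  moreover have der: "(cdf D has_real_derivative f z) (at z)" if "x < z" "z < y" for z
    using assms that by (intro cdf_has_derivative_at) auto
  ultimately obtain l z where "x < z" "z < y" "(cdf D has_real_derivative l) (at z)"
      "cdf D y - cdf D x = (y - x) * l"
    using MVT[OF \<open>x < y\<close>, of "cdf D"] by (auto simp: real_differentiable_def)
  with der[of z] show thesis
    using that DERIV_unique by blast
qed

lemma cdf_strict_mono:
  assumes "-1 \<le> x" "x < y" "y \<le> 1"
  shows "cdf D x < cdf D y"
proof -
  obtain z where z: "x < z" "z < y" "cdf D y - cdf D x = (y - x) * f z"
    using cdf_increment[OF assms] .
  then have "0 < (y - x) * f z"
    using assms density_pos[of z] by simp
  then show ?thesis using z by simp
qed

text \<open>The reflection of \<open>t\<close> to \<open>- t\<close> preserves Lebesgue measure and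
  the truncated density, so the two tails have equal mass. No bound on \<open>x\<close> is needed
  because the indicator is symmetric as well.\<close>

lemma cdf_uminus: "cdf D (- x) = 1 - cdf D x"
proof -
  let ?g = "\<lambda>t. ennreal (indicator {-1..1} t * f t)"
  have g: "?g \<in> borel_measurable borel"
    using density_borel by simp
  have "emeasure D {..- x} = (\<integral>\<^sup>+t. ?g t * indicator {..- x} t \<partial>lborel)"
    unfolding D_eq using g by (subst emeasure_density) auto
  also have "\<dots> = (\<integral>\<^sup>+t. ?g (- t) * indicator {..- x} (- t) \<partial>lborel)"
    using g by (subst nn_integral_real_affine[where c = "-1" and t = 0]) auto
  \<comment> \<open>Reflection produces the closed half-line from \<open>x\<close>; the endpoint is
    a null set.\<close>
  also have "\<dots> = (\<integral>\<^sup>+t. ?g t * indicator {x<..} t \<partial>lborel)"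
    using AE_lborel_singleton[of x] density_uminus
    by (intro nn_integral_cong_AE) (auto elim!: eventually_mono simp: indicator_def)
  also have "\<dots> = emeasure D {x<..}"
    unfolding D_eq using g by (subst emeasure_density) auto
  finally have "measure D {..- x} = measure D {x<..}"
    by (simp add: measure_def)
  also have "{x<..} = space D - {..x}"
    by auto
  also have "measure D (space D - {..x}) = 1 - measure D {..x}"
    by (rule prob_compl) simp
  finally show ?thesis by (simp add: cdf_def)
qed

lemma cdf_0: "cdf D 0 = 1 / 2"
  using cdf_uminus[of 0] by simp

section \<open>The pricing problem on one segment\<close>

text \<open>The first two bounds keep the cutoffs nonzero and at least halve them at each stage, as
  a cutoff is half a price; the third is the comparison with the benchmark price.\<close>

lemma lowest_maximizer_properties:
  assumes c: "0 < c * loc i" "c * loc i \<le> 1"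
  shows "0 < lowest_maximizer (cdf D) i c"
    and "lowest_maximizer (cdf D) i c \<le> c * loc i"
    and "lowest_maximizer (cdf D) i c < 1 / f 0"
proof -
  define k where "k = c * loc i"
  have k: "0 < k" "k \<le> 1" using c by (auto simp: k_def)
  define h where "h p = p * (cdf D k - cdf D (p / 2))" for p
  \<comment> \<open>Reflection turns the problem of firm \<open>L\<close> into that of firm
    \<open>R\<close>, so both maximize the same \<open>h\<close>.\<close>
  have "p * loc i * (cdf D c - cdf D (p * loc i / 2)) = h p" for p
    by (cases i) (simp_all add: h_def k_def cdf_uminus algebra_simps)
  then have lm: "lowest_maximizer (cdf D) i c = (LEAST p. is_arg_max h (\<lambda>p. 0 \<le> p) p)"
    by (simp add: lowest_maximizer_def)
  have cont: "continuous_on {0..2 * k} h"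
    unfolding h_def
    by (intro continuous_intros continuous_on_compose2[OF continuous_cdf]) (use k in auto)
  have hk: "0 < h k"
    using k cdf_strict_mono[of "k / 2" k] by (simp add: h_def)
  \<comment> \<open>Once \<open>p / 2\<close> reaches \<open>k\<close>, no demand is left. Since
    \<open>h k\<close> is positive, the search can be confined to a compact interval.\<close>
  have h_outside: "h p \<le> 0" if "p = 0 \<or> 2 * k \<le> p" for p
    using that k cdf_nondecreasing[of k "p / 2"] by (auto simp: h_def mult_le_0_iff)
  obtain m where m: "m \<in> {0..2 * k}" "\<And>p. p \<in> {0..2 * k} \<Longrightarrow> h p \<le> h m"
    using continuous_attains_sup[OF compact_Icc _ cont] k by (metis atLeastAtMost_iff empty_iff
        less_eq_real_def mult_pos_pos zero_less_numeral)
  have hm: "h p \<le> h m" if "0 \<le> p" for p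
  proof (cases "p \<le> 2 * k")
    case False
    then have "h p \<le> 0" using h_outside by simp
    also have "\<dots> < h k" by (rule hk)
    also have "\<dots> \<le> h m" using m k by simp
    finally show ?thesis by simp
  qed (use that m in auto)
  \<comment> \<open>The maximizers form a compact level set, which has a least element; this makes
    \<open>LEAST\<close> well defined.\<close>
  have argmax: "is_arg_max h (\<lambda>p. 0 \<le> p) p \<longleftrightarrow> p \<in> {0..2 * k} \<inter> h -` {h m}" for p
  proof
    assume p: "is_arg_max h (\<lambda>p. 0 \<le> p) p"
    then have "0 \<le> p" "h p = h m"
      using hm[of p] m(1) by (auto simp: is_arg_max_linorder intro!: antisym)
    moreover have "p \<le> 2 * k"
      using h_outside[of p] hk hm[of k] k \<open>h p = h m\<close> by fastforce
    ultimately show "p \<in> {0..2 * k} \<inter> h -` {h m}" by simp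
  next
    assume "p \<in> {0..2 * k} \<inter> h -` {h m}"
    then show "is_arg_max h (\<lambda>p. 0 \<le> p) p"
      using hm by (auto simp: is_arg_max_linorder)
  qed
  have "compact ({0..2 * k} \<inter> h -` {h m})"
    using continuous_on_closed_vimage[THEN iffD1, rule_format, OF _ cont, of "{h m}"]
    by (metis closed_atLeastAtMost closed_singleton compact_Icc compact_Int_closed inf_commute inf_left_idem)
  moreover have "m \<in> {0..2 * k} \<inter> h -` {h m}"
    using m by simp
  ultimately obtain l where l: "l \<in> {0..2 * k} \<inter> h -` {h m}"
      "\<And>p. p \<in> {0..2 * k} \<inter> h -` {h m} \<Longrightarrow> l \<le> p"
    using compact_attains_inf by (metis empty_iff)
  have l_eq: "lowest_maximizer (cdf D) i c = l"
    unfolding lm using l argmax by (intro Least_equality) auto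
  have hl: "h l = h m" "0 \<le> l" using l by auto
  have pos: "0 < h l" using hk hm[of k] k hl by simp
  have l_bounds: "0 < l" "l < 2 * k"
    using h_outside[of l] pos hl(2) by (force simp: not_le[symmetric])+
  define x where "x = l / 2"
  have x: "0 < x" "x < k" using l_bounds by (auto simp: x_def)
  \<comment> \<open>The chain rule factor \<open>1 / 2\<close> turns the price \<open>l\<close> into
    \<open>x\<close> in the last term.\<close>
  have "(h has_real_derivative (cdf D k - cdf D x) - x * f x) (at l)"
    unfolding h_def x_def
    by (rule derivative_eq_intros DERIV_chain2[OF cdf_has_derivative_at] refl
        | use x k in \<open>simp add: x_def\<close>)+
  \<comment> \<open>The neighbourhood of radius \<open>l\<close> around \<open>l\<close> contains
    only nonnegative prices, where \<open>l\<close> is optimal.\<close>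
  then have foc: "cdf D k - cdf D x = x * f x"
    using DERIV_local_max[of h _ l l] l_bounds hm hl(1) by fastforce
  have fx: "0 < f x" "0 < f 0" using x k density_pos by auto
  show "0 < lowest_maximizer (cdf D) i c" using l_bounds l_eq by simp
  obtain z where z: "x < z" "z < k" "cdf D k - cdf D x = (k - x) * f z"
    using cdf_increment[of x k] x k by auto
  have "(k - x) * f z \<le> (k - x) * f x"
    using z density_antimono[of x z] x k by (intro mult_left_mono) auto
  then have "x * f x \<le> (k - x) * f x"
    using foc z(3) by simp
  then have "x \<le> k - x" using fx by simp
  then show "lowest_maximizer (cdf D) i c \<le> c * loc i"
    using l_eq by (simp add: x_def k_def)
  \<comment> \<open>The derivative of \<open>G\<close> is the gap in \<open>density_shift\<close>,
    so monotonicity of \<open>G\<close> replaces integration of that inequality.\<close>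
  define G where "G u = cdf D (u - x) * f x - cdf D u * f 0" for u
  have "G x \<le> G k"
  \<comment> \<open>Derivatives are taken only in the interior: \<open>k\<close> may be
    \<open>1\<close>, where only a one-sided derivative is available.\<close>
  proof (rule DERIV_nonneg_imp_increasing_open[of x k])
    fix u assume u: "x < u" "u < k"
    have "(G has_real_derivative f (u - x) * f x - f u * f 0) (at u)"
      unfolding G_def
      by (rule derivative_eq_intros DERIV_chain2[OF cdf_has_derivative_at] cdf_has_derivative_at refl
        | use u x k in simp)+
    moreover have "0 \<le> f (u - x) * f x - f u * f 0"
      using density_shift[of x u] u x k by (simp add: mult.commute)
    ultimately show "\<exists>y. (G has_real_derivative y) (at u) \<and> 0 \<le> y" by blast
  next
    show "continuous_on {x..k} G"
      unfolding G_def
      by (intro continuous_intros continuous_on_compose2[OF continuous_cdf]) (use x k in auto)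
  qed (use x in simp)
  then have "(cdf D k - cdf D x) * f 0 \<le> (cdf D (k - x) - cdf D 0) * f x"
    by (simp add: G_def algebra_simps)
  then have "x * f 0 * f x \<le> (cdf D (k - x) - cdf D 0) * f x"
    using foc by (simp add: mult_ac)
  then have "x * f 0 \<le> cdf D (k - x) - 1 / 2"
    using fx cdf_0 by simp
  \<comment> \<open>Strictness comes from \<open>x > 0\<close>.\<close>
  also have "\<dots> < cdf D k - 1 / 2"
    using cdf_strict_mono[of "k - x" k] x k by simp
  also have "\<dots> \<le> 1 / 2" using cdf_bounded_prob[of k] by simp
  finally have "l * f 0 < 1" by (simp add: x_def)
  then show "lowest_maximizer (cdf D) i c < 1 / f 0"
    using l_eq fx by (simp add: field_simps)
qed

section \<open>Cutoffs and segments\<close>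

lemma cutoff_bounds: "0 < cutoff (cdf D) i s * loc i \<and> cutoff (cdf D) i s * loc i \<le> (1 / 2) ^ s"
proof (induction s)
  case 0
  then show ?case by (cases i) auto
next
  case (Suc s)
  have "(1 / 2 :: real) ^ s \<le> 1" by (simp add: power_le_one)
  with Suc have "cutoff (cdf D) i s * loc i \<le> 1" by linarith
  then show ?case
    using lowest_maximizer_properties(1,2)[of "cutoff (cdf D) i s" i] Suc
    by (cases i) auto
qed

text \<open>Index \<open>0\<close> is covered too: truncated subtraction makes it coincide with
  index \<open>1\<close>.\<close>

lemma segment_price_less: "segment_price (cdf D) i s < 1 / f 0"
proof -
  have "(1 / 2 :: real) ^ (s - 1) \<le> 1" by (simp add: power_le_one)
  then show ?thesis
    using cutoff_bounds[of i "s - 1"] unfolding segment_price_def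
    by (intro lowest_maximizer_properties(3)) auto
qed

lemma cutoff_1: "cutoff (cdf D) i 1 = segment_price (cdf D) i 1 * loc i / 2"
  by (simp add: segment_price_def)

text \<open>The cutoffs shrink geometrically to \<open>0\<close>, so some cutoff lies below the
  type; the least such index works. It is not \<open>0\<close>, as the initial cutoff is the
  location of the firm.\<close>

lemma segment_cover:
  assumes "0 < t * loc i" "t \<in> {-1..1}"
  obtains s where "1 \<le> s" "cutoff (cdf D) i s * loc i < t * loc i"
    "t * loc i \<le> cutoff (cdf D) i (s - 1) * loc i"
proof -
  let ?P = "\<lambda>s. cutoff (cdf D) i s * loc i < t * loc i"
  obtain n where "(1 / 2) ^ n < t * loc i"
    using real_arch_pow_inv[of "t * loc i" "1 / 2"] assms by auto
  then have "?P n" using cutoff_bounds[of i n] by linarith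
  define s where "s = (LEAST s. ?P s)"
  have s: "?P s" unfolding s_def by (rule LeastI) fact
  have "\<not> ?P 0" using assms by (cases i) auto
  then have "1 \<le> s" using s by (cases s) auto
  moreover have "\<not> ?P (s - 1)"
    using \<open>1 \<le> s\<close> not_less_Least[of "s - 1" ?P] by (simp add: s_def)
  ultimately show thesis using that s by auto
qed

section \<open>Comparison of payoffs\<close>

lemma nearer_iff: "(\<forall>j. \<bar>t - loc i\<bar> \<le> \<bar>t - loc j\<bar>) \<longleftrightarrow> 0 \<le> t * loc i" if "t \<in> {-1..1}"
proof
  assume "\<forall>j. \<bar>t - loc i\<bar> \<le> \<bar>t - loc j\<bar>"
  then have "\<bar>t - loc i\<bar> \<le> \<bar>t - loc L\<bar>" "\<bar>t - loc i\<bar> \<le> \<bar>t - loc R\<bar>" by blast+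
  then show "0 \<le> t * loc i" using that by (cases i) (auto simp: abs_if split: if_splits)
next
  assume *: "0 \<le> t * loc i"
  show "\<forall>j. \<bar>t - loc i\<bar> \<le> \<bar>t - loc j\<bar>"
  proof
    fix j show "\<bar>t - loc i\<bar> \<le> \<bar>t - loc j\<bar>"
      using that * by (cases i; cases j) auto
  qed
qed

text \<open>At \<open>t = 0\<close> the sellers in the two outcomes may differ, but both are
  nearest, so travel costs agree and only prices matter. The price bound is therefore required of
  every nearest firm.\<close>

lemma payoff_less:
  assumes t: "t \<in> {-1..1}"
    and benchmark: "benchmark_equilibrium D f q b"
    and nearer: "buys_from_nearer (buy E) t (prices_faced E t)"
    and price: "\<And>i. 0 \<le> t * loc i \<Longrightarrow> prices_faced E t i < 1 / f 0"
  shows "consumer_payoff V b t q < disclosure_payoff V E t"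
proof -
  have q: "q i = 1 / f 0" for i
    using benchmark by (simp add: benchmark_equilibrium_def cdf_0)
  obtain i where i: "b t q = Some i" "\<forall>j. \<bar>t - loc i\<bar> \<le> \<bar>t - loc j\<bar>"
    using benchmark t unfolding benchmark_equilibrium_def buys_from_nearer_def by blast
  obtain j where j: "buy E t (prices_faced E t) = Some j" "\<forall>i. \<bar>t - loc j\<bar> \<le> \<bar>t - loc i\<bar>"
    using nearer by (auto simp: buys_from_nearer_def)
  have "prices_faced E t j < 1 / f 0"
    using price nearer_iff[OF t] j(2) by simp
  moreover have "\<bar>t - loc i\<bar> = \<bar>t - loc j\<bar>"
    using i(2) j(2) by (intro antisym) auto
  ultimately show ?thesis
    using i(1) j(1) q by (simp add: consumer_payoff_def disclosure_payoff_def)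
qed

text \<open>A revealed type strictly inside the first cutoff pays twice its distance from
  \<open>0\<close>, which is less than twice that of the cutoff, namely the pooling price. All other
  types pay the pooling price itself.\<close>

lemma simple_price_less:
  assumes t: "t \<in> {-1..1}" and E: "simple_equilibrium D E" and i: "0 \<le> t * loc i"
  shows "prices_faced E t i < 1 / f 0"
proof -
  let ?c = "cutoff (cdf D)"
  have f0: "0 < 1 / f 0" using density_pos[of 0] by simp
  have price: "price E i {t} = max (2 * t * loc i) 0"
      "price E i {-1..1} = segment_price (cdf D) i 1"
    using E t unfolding simple_equilibrium_def by blast+
  have c: "?c L 1 < 0" "0 < ?c R 1"
    using cutoff_bounds[of L 1] cutoff_bounds[of R 1] by simp_all
  have msg: "if t * loc i < ?c i 1 * loc i then msg E i t = {t} else msg E i t = {-1..1}"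
  proof -
    consider "t \<in> {-1..?c L 1}" | "t \<in> {?c L 1<..<?c R 1}" | "t \<in> {?c R 1..1}"
      using t by force
    then show ?thesis
    proof cases
      case 1
      then have "msg E L t = {-1..1}" using E unfolding simple_equilibrium_def by blast
      then show ?thesis using 1 c i by (cases i) auto
    next
      case 2
      then have "msg E L t = {t}" "msg E R t = {t}"
        using E unfolding simple_equilibrium_def by blast+
      then show ?thesis using 2 by (cases i) auto
    next
      case 3
      then have "msg E R t = {-1..1}" using E unfolding simple_equilibrium_def by blast
      then show ?thesis using 3 c i by (cases i) auto
    qed
  qed
  show ?thesis
  proof (cases "t * loc i < ?c i 1 * loc i")
    case True
    then have "prices_faced E t i = 2 * (t * loc i)"
      using msg price i by (simp add: prices_faced_def mult_ac)
    also have "\<dots> < 2 * (?c i 1 * loc i)" using True by simp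
    also have "\<dots> = segment_price (cdf D) i 1" unfolding cutoff_1 by (cases i) auto
    also have "\<dots> < 1 / f 0" by (rule segment_price_less)
    finally show ?thesis .
  next
    case False
    then show ?thesis
      using msg price segment_price_less by (simp add: prices_faced_def)
  qed
qed

text \<open>Type \<open>0\<close> is treated apart: the cutoffs stay nonzero, so it belongs to no
  segment.\<close>

lemma rich_price_less:
  assumes t: "t \<in> {-1..1}" and E: "rich_equilibrium D E" and i: "0 \<le> t * loc i"
  shows "prices_faced E t i < 1 / f 0"
proof (cases "t = 0")
  case True
  have "\<forall>j. msg E j 0 = {0} \<and> price E j {0} = 0"
    using E unfolding rich_equilibrium_def by (elim conjE)
  then show ?thesis using True density_pos[of 0] by (simp add: prices_faced_def)
next
  case False
  then have "0 < t * loc i" using i by (cases i) auto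
  then obtain s where s: "1 \<le> s" "cutoff (cdf D) i s * loc i < t * loc i"
    "t * loc i \<le> cutoff (cdf D) i (s - 1) * loc i"
    using segment_cover t by blast
  then have "msg E i t = segment (cdf D) i s"
    using E t unfolding rich_equilibrium_def by blast
  moreover have "price E i (segment (cdf D) i s) = (if i = i then segment_price (cdf D) i s else 0)"
    using E s(1) unfolding rich_equilibrium_def by blast
  ultimately show ?thesis
    using segment_price_less by (simp add: prices_faced_def)
qed

end

theorem proposition8:
  fixes D :: "real measure" and f :: "real \<Rightarrow> real" and V :: real
    and q :: "firm \<Rightarrow> real" and b :: purchase
    and E_simple E_rich :: profile
  assumes "duopoly D f V"
    and "symmetric_density f"
    and "log_concave_density f"
    and "benchmark_equilibrium D f q b"
    and "simple_equilibrium D E_simple"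
    and "rich_equilibrium D E_rich"
  shows "\<forall>t\<in>{-1..1}.
           disclosure_payoff V E_simple t > consumer_payoff V b t q \<and>
           disclosure_payoff V E_rich t > consumer_payoff V b t q"
proof -
  interpret symmetric_log_concave_duopoly D f V
    by unfold_locales fact+
  show ?thesis
  proof (intro ballI conjI)
    fix t :: real
    assume t: "t \<in> {-1..1}"
    have "buys_from_nearer (buy E_simple) t (prices_faced E_simple t)"
      using assms(5) t unfolding simple_equilibrium_def by (elim conjE bspec)
    then show "disclosure_payoff V E_simple t > consumer_payoff V b t q"
      using t assms(4,5) by (intro payoff_less simple_price_less)
    have "buys_from_nearer (buy E_rich) t (prices_faced E_rich t)"
      using assms(6) t unfolding rich_equilibrium_def by (elim conjE bspec)
    then show "disclosure_payoff V E_rich t > consumer_payoff V b t q"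
      using t assms(4,6) by (intro payoff_less rich_price_less)
  qed
qed

end
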